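(* Let $n\ge 3$ and $1\le k\le n-1$ be integers with $\gcd(n,k)=1$, and for a number $c$ let $p_c(z) = z^n + c\,\overline{z}^{\,k} - 1$ for $z\in\mathbb{C}$. Then the following hold. (a) If $c$ is real with $0<c<1$, then every zero $z\in\mathbb{C}$ of $p_c$ satisfies $(1-c)^{\frac{1}{n-k}} < |z| < (1+c)^{\frac{1}{n-k}}$. (b) If $c$ is real with $c\geq 1$, then every zero $z\in\mathbb{C}$ of $p_c$ with $|z| \geq 1$ satisfies $(c-1)^{\frac{1}{n-k}} \leq |z| \leq (1+c)^{\frac{1}{n-k}}$. (c) If $c \in \mathbb{C}$, then every zero $z\in\mathbb{C}$ of $p_c$ with $|z| \geq 1$ satisfies $(|c|-1)^{\frac{1}{n-k}} \leq |z| \leq (1+|c|)^{\frac{1}{n-k}}$.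
   Context: The bar denotes complex conjugation. For a nonnegative real $t$, $t^{1/(n-k)}$ denotes the nonnegative real $(n-k)$-th root. In part (c), the lower bound $(|c|-1)^{1/(n-k)}\le |z|$ is read as $|c|-1\le |z|^{n-k}$ (this matters only when $|c|<1$, where the base is negative). *)

theory Defs
  imports Complex_Main
begin

definition harmonic_trinomial :: "nat \<Rightarrow> nat \<Rightarrow> complex \<Rightarrow> complex \<Rightarrow> complex" where
  "harmonic_trinomial n k c z = z ^ n + c * cnj z ^ k - 1"

end

(* Each of the three terms of the equation z^n + c * cnj z^k = 1 is bounded in modulus by the sum of
   the other two. Dividing by |z|^k and comparing 1 with |z|^k gives all the bounds. *)
theory Submission
  imports Defs
begin

text \<open>With \<open>r = cmod z\<close>, the terms of \<open>z ^ n + c * cnj z ^ k = 1\<close>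
  have moduli \<open>r ^ n\<close>, \<open>cmod c * r ^ k\<close> and 1; conjugation leaves moduli
  unchanged. The triangle inequality bounds each by the sum of the other two. If the lone 1 can be
  traded for \<open>r ^ k\<close>, the factor \<open>r ^ k\<close> cancels and a bound on
  \<open>r ^ (n - k)\<close> remains. The trade is valid when \<open>r \<ge> 1\<close> for both
  upper and lower bounds of (b) and (c). For (a), it is strict on one side of the unit circle, and
  on the other side the bound is trivial. Taking roots finishes.\<close>

lemma harmonic_trinomial_zero_triangle:
  assumes "harmonic_trinomial n k c z = 0" and "k \<le> n"
  defines "r \<equiv> cmod z"
  shows "1 \<le> r ^ k * (r ^ (n - k) + cmod c)"
    and "r ^ k * r ^ (n - k) \<le> 1 + cmod c * r ^ k"
    and "cmod c * r ^ k \<le> 1 + r ^ k * r ^ (n - k)"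
proof -
  have eq: "z ^ n + c * cnj z ^ k = 1"
    using assms(1) by (simp add: harmonic_trinomial_def)
  \<comment> \<open>Splitting off \<open>r ^ k\<close> exposes the factor to be cancelled
    later.\<close>
  have n: "cmod (z ^ n) = r ^ k * r ^ (n - k)"
    using \<open>k \<le> n\<close> by (simp add: r_def norm_power flip: power_add)
  have k: "cmod (c * cnj z ^ k) = cmod c * r ^ k"
    by (simp add: r_def norm_mult norm_power)
  show "1 \<le> r ^ k * (r ^ (n - k) + cmod c)"
    using norm_triangle_ineq[of "z ^ n" "c * cnj z ^ k"] unfolding eq n k
    by (simp add: algebra_simps)
  have "z ^ n = 1 - c * cnj z ^ k" and "c * cnj z ^ k = 1 - z ^ n"
    using eq by (simp_all add: algebra_simps)
  then show "r ^ k * r ^ (n - k) \<le> 1 + cmod c * r ^ k"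
    and "cmod c * r ^ k \<le> 1 + r ^ k * r ^ (n - k)"
    using norm_triangle_ineq4[of 1 "c * cnj z ^ k"] norm_triangle_ineq4[of 1 "z ^ n"]
    by (simp_all flip: n k)
qed

lemma harmonic_trinomial_zero_outside_unit_disc:
  assumes "harmonic_trinomial n k c z = 0" and "k \<le> n" and "1 \<le> cmod z"
  shows "cmod c - 1 \<le> cmod z ^ (n - k)" and "cmod z ^ (n - k) \<le> 1 + cmod c"
proof -
  note tri = harmonic_trinomial_zero_triangle[OF assms(1,2)]
  have ge: "1 \<le> cmod z ^ k" using assms(3) by (rule one_le_power)
  have "cmod z ^ k * (cmod c - 1) \<le> cmod z ^ k * cmod z ^ (n - k)"
    using tri(3) ge by (simp add: algebra_simps)
  then show "cmod c - 1 \<le> cmod z ^ (n - k)"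
    using ge by (simp add: mult_le_cancel_left)
  have "cmod z ^ k * cmod z ^ (n - k) \<le> cmod z ^ k * (1 + cmod c)"
    using tri(2) ge by (simp add: algebra_simps)
  then show "cmod z ^ (n - k) \<le> 1 + cmod c"
    using ge by (simp add: mult_le_cancel_left)
qed

text \<open>Only zeros inside the unit disc need the equation: elsewhere the power is at least 1,
  which exceeds \<open>1 - cmod c\<close>.\<close>

lemma harmonic_trinomial_zero_power_gt:
  assumes "harmonic_trinomial n k c z = 0" and "0 < k" "k \<le> n" and "c \<noteq> 0"
  shows "1 - cmod c < cmod z ^ (n - k)"
proof (cases "cmod z < 1")
  case True
  then have lt: "cmod z ^ k < 1"
    using \<open>0 < k\<close> by (simp add: power_less_one_iff)
  have "1 \<le> cmod z ^ k * (cmod z ^ (n - k) + cmod c)"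
    using harmonic_trinomial_zero_triangle(1)[OF assms(1) \<open>k \<le> n\<close>] .
  \<comment> \<open>Strictness needs a positive second factor, supplied by
    \<open>c \<noteq> 0\<close>.\<close>
  also have "\<dots> < 1 * (cmod z ^ (n - k) + cmod c)"
    using lt \<open>c \<noteq> 0\<close> by (intro mult_strict_right_mono add_nonneg_pos) auto
  finally show ?thesis by simp
next
  case False
  then have "1 \<le> cmod z ^ (n - k)" by (intro one_le_power) simp
  moreover have "0 < cmod c" using \<open>c \<noteq> 0\<close> by simp
  ultimately show ?thesis by linarith
qed

text \<open>Mirror image of the lower bound: the equation matters only outside the closed disc,
  where \<open>1 < cmod z ^ k\<close> makes the comparison strict.\<close>

lemma harmonic_trinomial_zero_power_less:
  assumes "harmonic_trinomial n k c z = 0" and "0 < k" "k \<le> n" and "c \<noteq> 0"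
  shows "cmod z ^ (n - k) < 1 + cmod c"
proof (cases "1 < cmod z")
  case True
  then have gt: "1 < cmod z ^ k" using \<open>0 < k\<close> by (rule one_less_power)
  have "cmod z ^ k * cmod z ^ (n - k) < cmod z ^ k * (1 + cmod c)"
    using harmonic_trinomial_zero_triangle(2)[OF assms(1) \<open>k \<le> n\<close>] gt
    by (simp add: algebra_simps)
  then show ?thesis using gt by (simp add: mult_less_cancel_left)
next
  case False
  then have "cmod z ^ (n - k) \<le> 1" by (intro power_le_one) auto
  moreover have "0 < cmod c" using \<open>c \<noteq> 0\<close> by simp
  ultimately show ?thesis by linarith
qed

theorem theorem3p3:
  fixes n k :: nat
  assumes "n \<ge> 3" and "1 \<le> k" and "k \<le> n - 1" and "gcd n k = 1"
  shows "(\<forall>c::real. 0 < c \<and> c < 1 \<longrightarrow>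
            (\<forall>z::complex. harmonic_trinomial n k (complex_of_real c) z = 0 \<longrightarrow>
               root (n - k) (1 - c) < cmod z \<and> cmod z < root (n - k) (1 + c)))
       \<and> (\<forall>c::real. c \<ge> 1 \<longrightarrow>
            (\<forall>z::complex. harmonic_trinomial n k (complex_of_real c) z = 0 \<and> cmod z \<ge> 1 \<longrightarrow>
               root (n - k) (c - 1) \<le> cmod z \<and> cmod z \<le> root (n - k) (1 + c)))
       \<and> (\<forall>c::complex. \<forall>z::complex. harmonic_trinomial n k c z = 0 \<and> cmod z \<ge> 1 \<longrightarrow>
               cmod c - 1 \<le> cmod z ^ (n - k) \<and> cmod z \<le> root (n - k) (1 + cmod c))"
proof -
  have m: "0 < n - k" and k: "0 < k" "k \<le> n"
    using assms by auto
  have root_pow: "root (n - k) (cmod z ^ (n - k)) = cmod z" for z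
    using m by (simp add: real_root_power_cancel)
  \<comment> \<open>For positive index, \<open>root\<close> is odd and strictly increasing on all
    reals, so no sign condition on \<open>1 - c\<close> or \<open>cmod c - 1\<close> arises.\<close>
  have less: "root (n - k) x < root (n - k) y \<longleftrightarrow> x < y"
    and le: "root (n - k) x \<le> root (n - k) y \<longleftrightarrow> x \<le> y" for x y
    using m by simp_all
  have a: "root (n - k) (1 - c) < cmod z \<and> cmod z < root (n - k) (1 + c)"
    if "0 < c" and zero: "harmonic_trinomial n k (complex_of_real c) z = 0" for c z
  proof -
    have "complex_of_real c \<noteq> 0" using \<open>0 < c\<close> by simp
    from harmonic_trinomial_zero_power_gt[OF zero k this]
      harmonic_trinomial_zero_power_less[OF zero k this]
    have "1 - c < cmod z ^ (n - k)" and "cmod z ^ (n - k) < 1 + c"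
      using \<open>0 < c\<close> by simp_all
    then show ?thesis by (metis less root_pow)
  qed
  have c: "cmod c - 1 \<le> cmod z ^ (n - k)" "root (n - k) (cmod c - 1) \<le> cmod z"
      "cmod z \<le> root (n - k) (1 + cmod c)"
    if "harmonic_trinomial n k c z = 0" and "1 \<le> cmod z" for c z
    using harmonic_trinomial_zero_outside_unit_disc[OF that(1) k(2) that(2)]
    by (simp, metis le root_pow, metis le root_pow)
  \<comment> \<open>Part (b) is the complex case at a real \<open>c\<close>, whose modulus is
    \<open>c\<close> itself.\<close>
  have b: "root (n - k) (c - 1) \<le> cmod z \<and> cmod z \<le> root (n - k) (1 + c)"
    if "1 \<le> c" and "harmonic_trinomial n k (complex_of_real c) z = 0" and "1 \<le> cmod z" for c z
    using c(2,3)[OF that(2,3)] \<open>1 \<le> c\<close> by simp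
  show ?thesis using a b c(1,3) by blast
qed

end
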